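(* Let $\mathcal{A}\in\mathbb{C}^{I_1\times\cdots\times I_M\times I_1\times\cdots\times I_N}$, $\mathcal{B}\in\mathbb{C}^{I_1\times\cdots\times I_K\times I_1\times\cdots\times I_K}$, $\mathcal{U}\in\mathbb{C}^{I_1\times\cdots\times I_M\times I_1\times\cdots\times I_K}$ and $\mathcal{V}\in\mathbb{C}^{I_1\times\cdots\times I_K\times I_1\times\cdots\times I_N}$. Suppose: 1. $\mathcal{U}=\mathcal{X}_1+\mathcal{Y}_1$, where the column-tensors of $\mathcal{X}_1$ lie in $\mathfrak{C}(\mathcal{A})$ and the column-tensors of $\mathcal{Y}_1$ are orthogonal to $\mathfrak{C}(\mathcal{A})$; 2. $\mathcal{V}^H=\mathcal{X}_2+\mathcal{Y}_2$, where the column-tensors of $\mathcal{X}_2$ lie in $\mathfrak{C}(\mathcal{A}^H)$ and the column-tensors of $\mathcal{Y}_2$ are orthogonal to $\mathfrak{C}(\mathcal{A}^H)$; and, with $\mathcal{E}_i=\mathcal{Y}_i(\mathcal{Y}_i^H\mathcal{Y}_i)^{\dagger}$ for $i=1,2$, 3. $\mathcal{E}_2\mathcal{B}^{\dagger}\mathcal{E}_1^H\mathcal{Y}_1\mathcal{B}=\mathcal{E}_2$, $\ \mathcal{X}_1\mathcal{E}_1^H\mathcal{Y}_1\mathcal{B}=\mathcal{X}_1\mathcal{B}$, $\ \mathcal{Y}_1\mathcal{E}_1^H\mathcal{Y}_1=\mathcal{Y}_1$; 4. $\mathcal{B}\mathcal{Y}_2^H\mathcal{E}_2\mathcal{B}^{\dagger}\mathcal{E}_1^H=\mathcal{E}_1^H$,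 $\ \mathcal{B}\mathcal{Y}_2^H\mathcal{E}_2\mathcal{X}_2^H=\mathcal{B}\mathcal{X}_2^H$, $\ \mathcal{E}_2\mathcal{Y}_2^H\mathcal{E}_2=\mathcal{E}_2$. Then the tensor $$\mathcal{S}=\mathcal{A}+\mathcal{U}\star_K\mathcal{B}\star_K\mathcal{V}=\mathcal{A}+(\mathcal{X}_1+\mathcal{Y}_1)\star_K\mathcal{B}\star_K(\mathcal{X}_2+\mathcal{Y}_2)^H$$ has Moore-Penrose inverse $$\mathcal{S}^{\dagger}=\mathcal{A}^{\dagger}-\mathcal{E}_2\star_K\mathcal{X}_2^H\star_N\mathcal{A}^{\dagger}-\mathcal{A}^{\dagger}\star_M\mathcal{X}_1\star_K\mathcal{E}_1^H+\mathcal{E}_2\star_K(\mathcal{B}^{\dagger}+\mathcal{X}_2^H\star_N\mathcal{A}^{\dagger}\star_M\mathcal{X}_1)\star_K\mathcal{E}_1^H.$$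
   Context: $\mathbb{C}^{I_1\times\cdots\times I_M\times J_1\times\cdots\times J_N}$ is the set of complex arrays $\mathcal{A}=(a_{i_1,\dots,i_M,j_1,\dots,j_N})$ with $1\le i_k\le I_k$, $1\le j_k\le J_k$; addition is entrywise. For $\mathcal{A}\in\mathbb{C}^{I_1\times\cdots\times I_M\times J_1\times\cdots\times J_N}$ and $\mathcal{B}\in\mathbb{C}^{J_1\times\cdots\times J_N\times K_1\times\cdots\times K_L}$ the Einstein product is $$(\mathcal{A}\star_N\mathcal{B})_{i_1,\dots,i_M,k_1,\dots,k_L}=\sum_{j_1,\dots,j_N}a_{i_1,\dots,i_M,j_1,\dots,j_N}\,b_{j_1,\dots,j_N,k_1,\dots,k_L}.$$ Juxtaposition of tensors denotes the Einstein product over the full block of matching indices (e.g. $\mathcal{Y}_1^H\mathcal{Y}_1=\mathcal{Y}_1^H\star_M\mathcal{Y}_1$, $\mathcal{Y}_2^H\mathcal{Y}_2=\mathcal{Y}_2^H\star_N\mathcal{Y}_2$). The conjugate transpose is $(\mathcal{A}^H)_{j_1,\dots,j_N,i_1,\dots,i_M}=\overline{a_{i_1,\dots,i_M,j_1,\dots,j_N}}$. The Moore-Penrose inverse $\mathcal{A}^{\dagger}$ of $\mathcal{A}\in\mathbb{C}^{I_1\times\cdots\times I_M\times J_1\times\cdots\times J_N}$ is the tensor $\mathcal{X}\in\mathbb{C}^{J_1\times\cdots\times J_N\times I_1\times\cdots\times I_M}$ satisfying $\mathcal{A}\star_N\mathcal{X}\star_M\mathcal{A}=\mathcal{A}$,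 $\mathcal{X}\star_M\mathcal{A}\star_N\mathcal{X}=\mathcal{X}$, $(\mathcal{A}\star_N\mathcal{X})^H=\mathcal{A}\star_N\mathcal{X}$, $(\mathcal{X}\star_M\mathcal{A})^H=\mathcal{X}\star_M\mathcal{A}$. The column-tensors of $\mathcal{A}\in\mathbb{C}^{I_1\times\cdots\times I_M\times J_1\times\cdots\times J_N}$ are the subtensors $\mathbf{a}_{j_1,\dots,j_N}$ of size $I_1\times\cdots\times I_M$ obtained by fixing $j_1,\dots,j_N$. The column space $\mathfrak{C}(\mathcal{A})$ is the set of all complex linear combinations of the column-tensors of $\mathcal{A}$. A tensor $\mathbf{z}$ of size $I_1\times\cdots\times I_M$ is orthogonal to $\mathfrak{C}(\mathcal{A})$ if $\mathbf{z}^H\star_M\mathcal{A}=0$ (i.e. $\mathbf z$ lies in the left null space of $\mathcal{A}$); equivalently $\sum_{i_1,\dots,i_M}\overline{z_{i_1,\dots,i_M}}\,y_{i_1,\dots,i_M}=0$ for all $\mathbf{y}\in\mathfrak{C}(\mathcal{A})$. *)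

theory Defs
  imports Complex_Main "HOL-Library.Function_Algebras"
begin

text \<open>
  A tensor is a function of two multi-indices, the row block \<open>[i\<^sub>1, \<dots>, i\<^sub>M]\<close> and the
  column block \<open>[j\<^sub>1, \<dots>, j\<^sub>N]\<close>.  Entries outside the index range are required to be \<open>0\<close>
  (see \<open>tensors\<close>), so that equality of functions is equality of arrays, and the pointwise
  \<open>+\<close>, \<open>-\<close> and \<open>0\<close> of \<open>Function_Algebras\<close> are the entrywise operations.
\<close>

type_synonym tensor = "nat list \<Rightarrow> nat list \<Rightarrow> complex"

definition multi_indices :: "nat list \<Rightarrow> nat list set" where
  "multi_indices Is = {is. list_all2 (\<lambda>i n. 1 \<le> i \<and> i \<le> n) is Is}"

definition tensors :: "nat list \<Rightarrow> nat list \<Rightarrow> tensor set" where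
  "tensors Is Js =
     {A. \<forall>i j. i \<notin> multi_indices Is \<or> j \<notin> multi_indices Js \<longrightarrow> A i j = 0}"

definition dims :: "(nat \<Rightarrow> nat) \<Rightarrow> nat \<Rightarrow> nat list" where
  "dims I M = map I [1..<M + 1]"

text \<open>The subscript of the product is the list of sizes of the contracted block; the number
  of contracted indices is its length.\<close>

definition einstein :: "tensor \<Rightarrow> nat list \<Rightarrow> tensor \<Rightarrow> tensor"
    ("(_ \<star>\<^bsub>_\<^esub> _)" [70, 0, 71] 70) where
  "A \<star>\<^bsub>Js\<^esub> B = (\<lambda>i k. \<Sum>j\<in>multi_indices Js. A i j * B j k)"

definition ctranspose :: "tensor \<Rightarrow> tensor" ("(_\<^sup>H)" [1000] 1000) where
  "A\<^sup>H = (\<lambda>j i. cnj (A i j))"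

definition is_mp_inverse :: "nat list \<Rightarrow> nat list \<Rightarrow> tensor \<Rightarrow> tensor \<Rightarrow> bool" where
  "is_mp_inverse Is Js A X \<longleftrightarrow>
     X \<in> tensors Js Is \<and>
     A \<star>\<^bsub>Js\<^esub> X \<star>\<^bsub>Is\<^esub> A = A \<and>
     X \<star>\<^bsub>Is\<^esub> A \<star>\<^bsub>Js\<^esub> X = X \<and>
     (A \<star>\<^bsub>Js\<^esub> X)\<^sup>H = A \<star>\<^bsub>Js\<^esub> X \<and>
     (X \<star>\<^bsub>Is\<^esub> A)\<^sup>H = X \<star>\<^bsub>Is\<^esub> A"

definition mp_inverse :: "nat list \<Rightarrow> nat list \<Rightarrow> tensor \<Rightarrow> tensor" where
  "mp_inverse Is Js A = (THE X. is_mp_inverse Is Js A X)"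

definition column_tensor :: "tensor \<Rightarrow> nat list \<Rightarrow> nat list \<Rightarrow> complex" where
  "column_tensor A j = (\<lambda>i. A i j)"

definition column_space :: "nat list \<Rightarrow> tensor \<Rightarrow> (nat list \<Rightarrow> complex) set" where
  "column_space Js A =
     {y. \<exists>c. y = (\<lambda>i. \<Sum>j\<in>multi_indices Js. c j * column_tensor A j i)}"

text \<open>A tensor of size \<open>I\<^sub>1 \<times> \<dots> \<times> I\<^sub>M\<close> viewed as one with empty column block, whose only
  multi-index is \<open>[]\<close>; this gives a meaning to \<open>z\<^sup>H \<star>\<^sub>M A\<close>.\<close>

definition single_column :: "(nat list \<Rightarrow> complex) \<Rightarrow> tensor" where
  "single_column z = (\<lambda>i k. if k = [] then z i else 0)"

definition orthogonal_to_column_space :: "nat list \<Rightarrow> tensor \<Rightarrow> (nat list \<Rightarrow> complex) \<Rightarrow> bool" where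
  "orthogonal_to_column_space Is A z \<longleftrightarrow> (single_column z)\<^sup>H \<star>\<^bsub>Is\<^esub> A = 0"

end

theory Submission
  imports Defs
begin

text \<open>
  Tensors under the Einstein product behave like rectangular matrices, and the claim is a
  computation with the four Penrose equations.  Write \<open>D\<close> for the Moore-Penrose inverse of
  \<open>A\<close> and \<open>T\<close> for the asserted inverse of \<open>S\<close>.  The range conditions say that
  \<open>X\<^sub>1 = A C\<^sub>1\<close> and \<open>X\<^sub>2 = A\<^sup>H C\<^sub>2\<close> for some coefficient tensors, and the orthogonality
  conditions say that \<open>Y\<^sub>1\<^sup>H A = 0\<close> and \<open>A Y\<^sub>2 = 0\<close>.  Since \<open>D\<close> factors through \<open>A\<^sup>H\<close> on both
  sides, \<open>D Y\<^sub>1 = 0\<close> and \<open>Y\<^sub>2\<^sup>H D = 0\<close> as well, so most mixed products vanish when \<open>S T\<close> and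
  \<open>T S\<close> are expanded.  The compatibility conditions on \<open>B\<close> collapse what is left to
  \[ S T = A D + Y_1 E_1^H, \qquad T S = D A + E_2 Y_2^H. \]
  Both are Hermitian, because \<open>E\<^sub>i = Y\<^sub>i (Y\<^sub>i\<^sup>H Y\<^sub>i)\<^sup>\<dagger>\<close> and the inverse of a Hermitian tensor
  is Hermitian; multiplying once more gives \<open>S T S = S\<close> and \<open>T S T = T\<close>.  This is
  \<open>is_mp_inverse_modified\<close>.

  The Moore-Penrose inverse is given by a definite description, so that it has to be shown to
  exist and to be unique.  Uniqueness is the usual argument with \<open>A X = A Y\<close> and \<open>X A = Y A\<close>.
  For existence, a linear map over a field has an inner inverse
  (\<open>inner_inverse_exists\<close>); applied to \<open>A\<^sup>H A\<close> this yields, by positive definiteness, an inner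
  inverse \<open>X\<close> of \<open>A\<close> for which \<open>A X\<close> is Hermitian, by conjugate transposition one for which
  \<open>X A\<close> is, and a product of the two satisfies all four equations.
\<close>

section \<open>The algebra of the Einstein product\<close>

lemma finite_multi_indices [simp]: "finite (multi_indices Is)"
proof (induction Is)
  case Nil
  then show ?case by (simp add: multi_indices_def)
next
  case (Cons n Is)
  have "multi_indices (n # Is) \<subseteq> (\<lambda>(i, is). i # is) ` ({1..n} \<times> multi_indices Is)"
    by (auto simp: multi_indices_def list_all2_Cons2)
  then show ?case
    using Cons by (meson finite_SigmaI finite_atLeastAtMost finite_imageI finite_subset)
qed

lemma einstein_assoc: "A \<star>\<^bsub>Is\<^esub> B \<star>\<^bsub>Js\<^esub> C = A \<star>\<^bsub>Is\<^esub> (B \<star>\<^bsub>Js\<^esub> C)"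
proof (intro ext)
  fix i k
  have "(A \<star>\<^bsub>Is\<^esub> B \<star>\<^bsub>Js\<^esub> C) i k
      = (\<Sum>j\<in>multi_indices Js. \<Sum>l\<in>multi_indices Is. A i l * B l j * C j k)"
    by (simp add: einstein_def sum_distrib_right)
  also have "\<dots> = (\<Sum>l\<in>multi_indices Is. \<Sum>j\<in>multi_indices Js. A i l * B l j * C j k)"
    by (rule sum.swap)
  also have "\<dots> = (A \<star>\<^bsub>Is\<^esub> (B \<star>\<^bsub>Js\<^esub> C)) i k"
    by (simp add: einstein_def sum_distrib_left mult.assoc)
  finally show "(A \<star>\<^bsub>Is\<^esub> B \<star>\<^bsub>Js\<^esub> C) i k = (A \<star>\<^bsub>Is\<^esub> (B \<star>\<^bsub>Js\<^esub> C)) i k" .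
qed

text \<open>Products are kept in right-associated form below; this turns an equation for a product
  of two factors into a rewrite rule that also applies when further factors follow.\<close>

lemma einstein_extend:
  assumes "A \<star>\<^bsub>Is\<^esub> B = C"
  shows "A \<star>\<^bsub>Is\<^esub> (B \<star>\<^bsub>Js\<^esub> Z) = C \<star>\<^bsub>Js\<^esub> Z"
  using assms by (simp flip: einstein_assoc)

lemma einstein_distribs:
  "(A + B) \<star>\<^bsub>Is\<^esub> C = A \<star>\<^bsub>Is\<^esub> C + B \<star>\<^bsub>Is\<^esub> C"
  "C \<star>\<^bsub>Is\<^esub> (A + B) = C \<star>\<^bsub>Is\<^esub> A + C \<star>\<^bsub>Is\<^esub> B"
  "(A - B) \<star>\<^bsub>Is\<^esub> C = A \<star>\<^bsub>Is\<^esub> C - B \<star>\<^bsub>Is\<^esub> C"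
  "C \<star>\<^bsub>Is\<^esub> (A - B) = C \<star>\<^bsub>Is\<^esub> A - C \<star>\<^bsub>Is\<^esub> B"
  by (auto simp: einstein_def fun_eq_iff algebra_simps sum.distrib sum_subtractf)

lemma einstein_zero [simp]: "0 \<star>\<^bsub>Is\<^esub> A = 0" "A \<star>\<^bsub>Is\<^esub> 0 = 0"
  by (auto simp: einstein_def fun_eq_iff)

lemma ctranspose_einstein: "(A \<star>\<^bsub>Is\<^esub> B)\<^sup>H = B\<^sup>H \<star>\<^bsub>Is\<^esub> A\<^sup>H"
  by (auto simp: einstein_def ctranspose_def fun_eq_iff mult.commute)

lemma ctranspose_ctranspose [simp]: "(A\<^sup>H)\<^sup>H = A"
  by (simp add: ctranspose_def)

lemma ctranspose_add: "(A + B)\<^sup>H = A\<^sup>H + B\<^sup>H"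
  and ctranspose_diff: "(A - B)\<^sup>H = A\<^sup>H - B\<^sup>H"
  and ctranspose_zero [simp]: "0\<^sup>H = 0"
  by (auto simp: ctranspose_def fun_eq_iff)

lemma ctranspose_tensors: "A \<in> tensors Is Js \<Longrightarrow> A\<^sup>H \<in> tensors Js Is"
  by (auto simp: tensors_def ctranspose_def)

lemma einstein_tensors:
  "A \<in> tensors Is Js \<Longrightarrow> B \<in> tensors Ks Ls \<Longrightarrow> A \<star>\<^bsub>Ms\<^esub> B \<in> tensors Is Ls"
  by (auto simp: tensors_def einstein_def)

lemma diff_tensors: "A \<in> tensors Is Js \<Longrightarrow> B \<in> tensors Is Js \<Longrightarrow> A - B \<in> tensors Is Js"
  by (auto simp: tensors_def)

text \<open>The diagonal entries of \<open>A\<^sup>H A\<close> are the squared norms of the column-tensors of \<open>A\<close>.\<close>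

lemma ctranspose_einstein_self_eq_0:
  assumes A: "A \<in> tensors Is Js" and zero: "A\<^sup>H \<star>\<^bsub>Is\<^esub> A = 0"
  shows "A = 0"
proof (intro ext)
  fix i j
  have "complex_of_real (\<Sum>i\<in>multi_indices Is. (cmod (A i j))\<^sup>2) = (A\<^sup>H \<star>\<^bsub>Is\<^esub> A) j j"
    unfolding einstein_def ctranspose_def of_real_sum
    by (intro sum.cong refl) (metis complex_norm_square mult.commute)
  then have "(\<Sum>i\<in>multi_indices Is. (cmod (A i j))\<^sup>2) = 0"
    by (simp add: zero flip: of_real_sum of_real_power)
  then have "\<forall>i\<in>multi_indices Is. A i j = 0"
    by (subst (asm) sum_nonneg_eq_0_iff) auto
  then show "A i j = 0 i j"
    using A by (auto simp: tensors_def)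
qed

section \<open>Existence and uniqueness of the Moore-Penrose inverse\<close>

text \<open>The linear map \<open>f\<close> with matrix \<open>A\<close> has a linear right inverse \<open>g\<close> on its range; the
  matrix of \<open>g\<close> is an inner inverse of \<open>A\<close>, because the column-tensors of \<open>A\<close> lie in that
  range.\<close>

lemma inner_inverse_exists:
  assumes A: "A \<in> tensors Is Js"
  shows "\<exists>G\<in>tensors Js Is. A \<star>\<^bsub>Js\<^esub> G \<star>\<^bsub>Is\<^esub> A = A"
proof -
  define scale :: "complex \<Rightarrow> (nat list \<Rightarrow> complex) \<Rightarrow> nat list \<Rightarrow> complex"
    where "scale = (\<lambda>c v i. c * v i)"
  interpret vector_space_pair scale scale
    by unfold_locales (auto simp: scale_def fun_eq_iff algebra_simps)
  define f where "f v = (\<lambda>i. \<Sum>j\<in>multi_indices Js. A i j * v j)" for v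
  have f: "Vector_Spaces.linear scale scale f"
    by unfold_locales
      (auto simp: f_def scale_def fun_eq_iff algebra_simps sum.distrib sum_distrib_left)
  obtain g where g: "Vector_Spaces.linear scale scale g" and fg: "\<And>v. f (g (f v)) = f v"
    using linear_exists_right_inverse_on[OF f vs1.subspace_UNIV] by auto
  define unit :: "nat list \<Rightarrow> nat list \<Rightarrow> complex"
    where "unit i = (\<lambda>l. if l = i then 1 else 0)" for i
  define G :: tensor where
    "G = (\<lambda>j i. if j \<in> multi_indices Js \<and> i \<in> multi_indices Is then g (unit i) j else 0)"
  have fun_sum: "(\<Sum>x\<in>X. h x) y = (\<Sum>x\<in>X. h x y)"
    for X and h :: "nat list \<Rightarrow> nat list \<Rightarrow> complex" and y
    by (induction X rule: infinite_finite_induct) auto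
  have "A \<star>\<^bsub>Js\<^esub> G \<star>\<^bsub>Is\<^esub> A = A"
  proof (intro ext)
    fix i k
    have column: "(\<lambda>i. A i k) = f (unit k)" if "k \<in> multi_indices Js"
      using that by (auto simp: f_def unit_def fun_eq_iff if_distrib cong: if_cong)
    have expand: "(\<lambda>i. A i k) = (\<Sum>i\<in>multi_indices Is. scale (A i k) (unit i))"
      using A by (auto simp: fun_eq_iff fun_sum scale_def unit_def tensors_def if_distrib
          cong: if_cong)
    have g_column: "g (\<lambda>i. A i k) j = (\<Sum>i\<in>multi_indices Is. A i k * g (unit i) j)" for j
      unfolding expand linear_sum[OF g] linear_scale[OF g] fun_sum
      by (simp add: scale_def)
    have "(A \<star>\<^bsub>Js\<^esub> G \<star>\<^bsub>Is\<^esub> A) i k = f (g (\<lambda>i. A i k)) i"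
      unfolding einstein_assoc f_def g_column
      by (auto simp: einstein_def G_def mult.commute intro!: sum.cong)
    also have "\<dots> = A i k"
    proof (cases "k \<in> multi_indices Js")
      case True
      then show ?thesis using column fg by metis
    next
      case False
      then have "(\<lambda>i. A i k) = 0"
        using A by (auto simp: tensors_def)
      then show ?thesis
        using linear_0[OF g] linear_0[OF f] by (metis zero_fun_apply)
    qed
    finally show "(A \<star>\<^bsub>Js\<^esub> G \<star>\<^bsub>Is\<^esub> A) i k = A i k" .
  qed
  moreover have "G \<in> tensors Js Is"
    by (auto simp: tensors_def G_def)
  ultimately show ?thesis by blast
qed

text \<open>The least squares inverse \<open>(A\<^sup>H A)\<^sup>- A\<^sup>H\<close>: the defect \<open>A X A - A\<close> is annihilated by
  \<open>A\<^sup>H\<close> and is of the form \<open>A Z\<close>, hence orthogonal to itself.\<close>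

lemma hermitian_inner_inverse_exists:
  assumes A: "A \<in> tensors Is Js"
  shows "\<exists>X\<in>tensors Js Is. A \<star>\<^bsub>Js\<^esub> X \<star>\<^bsub>Is\<^esub> A = A \<and> (A \<star>\<^bsub>Js\<^esub> X)\<^sup>H = A \<star>\<^bsub>Js\<^esub> X"
proof -
  have AH: "A\<^sup>H \<in> tensors Js Is"
    using A by (rule ctranspose_tensors)
  obtain G where G: "G \<in> tensors Js Js"
    and GG: "A\<^sup>H \<star>\<^bsub>Is\<^esub> A \<star>\<^bsub>Js\<^esub> G \<star>\<^bsub>Js\<^esub> (A\<^sup>H \<star>\<^bsub>Is\<^esub> A) = A\<^sup>H \<star>\<^bsub>Is\<^esub> A"
    using inner_inverse_exists[OF einstein_tensors[OF AH A]] by blast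
  define X where "X = G \<star>\<^bsub>Js\<^esub> A\<^sup>H"
  define P where "P = A \<star>\<^bsub>Js\<^esub> X"
  define F where "F = P \<star>\<^bsub>Is\<^esub> A - A"
  have X: "X \<in> tensors Js Is"
    unfolding X_def using G AH by (rule einstein_tensors)
  have F: "F \<in> tensors Is Js"
    unfolding F_def P_def by (intro diff_tensors einstein_tensors[OF einstein_tensors[OF A X] A] A)
  have AF: "A\<^sup>H \<star>\<^bsub>Is\<^esub> F = 0"
    using GG by (simp add: F_def P_def X_def einstein_distribs einstein_assoc)
  \<comment> \<open>\<open>F\<^sup>H\<close> has a right factor \<open>A\<^sup>H\<close>, which kills \<open>F\<close>.\<close>
  have "F\<^sup>H = (X \<star>\<^bsub>Is\<^esub> A)\<^sup>H \<star>\<^bsub>Js\<^esub> A\<^sup>H - A\<^sup>H"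
    by (simp add: F_def P_def ctranspose_diff ctranspose_einstein einstein_assoc)
  then have "F\<^sup>H \<star>\<^bsub>Is\<^esub> F = 0"
    by (simp add: einstein_distribs einstein_assoc AF)
  then have "F = 0"
    using F ctranspose_einstein_self_eq_0 by blast
  then have PA: "P \<star>\<^bsub>Is\<^esub> A = A"
    by (simp add: F_def)
  \<comment> \<open>\<open>P\<^sup>H\<close> is of the form \<open>A Z\<close>, so \<open>P\<close> fixes it; and \<open>P P\<^sup>H\<close> is Hermitian.\<close>
  have "P\<^sup>H = A \<star>\<^bsub>Js\<^esub> (G\<^sup>H \<star>\<^bsub>Js\<^esub> A\<^sup>H)"
    by (simp add: P_def X_def ctranspose_einstein einstein_assoc)
  then have PP: "P \<star>\<^bsub>Is\<^esub> P\<^sup>H = P\<^sup>H"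
    using einstein_extend[OF PA] by simp
  then have "P\<^sup>H = P"
    by (metis ctranspose_ctranspose ctranspose_einstein)
  then show ?thesis
    using X PA unfolding P_def by blast
qed

text \<open>If \<open>Y\<close> and \<open>Z\<close> are inner inverses with \<open>A Y\<close> and \<open>Z A\<close> Hermitian, then \<open>X = Z A Y\<close>
  inherits both properties, because \<open>A X = A Y\<close> and \<open>X A = Z A\<close>.\<close>

lemma mp_inverse_exists:
  assumes A: "A \<in> tensors Is Js"
  shows "\<exists>X. is_mp_inverse Is Js A X"
proof -
  obtain Y where Y: "Y \<in> tensors Js Is" "A \<star>\<^bsub>Js\<^esub> Y \<star>\<^bsub>Is\<^esub> A = A"
      "(A \<star>\<^bsub>Js\<^esub> Y)\<^sup>H = A \<star>\<^bsub>Js\<^esub> Y"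
    using hermitian_inner_inverse_exists[OF A] by blast
  obtain W where W: "W \<in> tensors Is Js" "A\<^sup>H \<star>\<^bsub>Is\<^esub> W \<star>\<^bsub>Js\<^esub> A\<^sup>H = A\<^sup>H"
      "(A\<^sup>H \<star>\<^bsub>Is\<^esub> W)\<^sup>H = A\<^sup>H \<star>\<^bsub>Is\<^esub> W"
    using hermitian_inner_inverse_exists[OF ctranspose_tensors[OF A]] by blast
  define Z where "Z = W\<^sup>H"
  have AYA: "A \<star>\<^bsub>Js\<^esub> (Y \<star>\<^bsub>Is\<^esub> A) = A"
    using Y(2) by (simp add: einstein_assoc)
  have AZA: "A \<star>\<^bsub>Js\<^esub> (Z \<star>\<^bsub>Is\<^esub> A) = A"
    using arg_cong[OF W(2), of ctranspose] by (simp add: Z_def ctranspose_einstein)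
  have ZA: "(Z \<star>\<^bsub>Is\<^esub> A)\<^sup>H = Z \<star>\<^bsub>Is\<^esub> A"
    using W(3) by (simp add: Z_def ctranspose_einstein)
  have AZA': "A \<star>\<^bsub>Js\<^esub> (Z \<star>\<^bsub>Is\<^esub> (A \<star>\<^bsub>Js\<^esub> V)) = A \<star>\<^bsub>Js\<^esub> V" for V
    using einstein_extend[OF AZA] by (simp add: einstein_assoc)
  define X where "X = Z \<star>\<^bsub>Is\<^esub> A \<star>\<^bsub>Js\<^esub> Y"
  have AX: "A \<star>\<^bsub>Js\<^esub> X = A \<star>\<^bsub>Js\<^esub> Y" and XA: "X \<star>\<^bsub>Is\<^esub> A = Z \<star>\<^bsub>Is\<^esub> A"
    by (simp_all add: X_def einstein_assoc AYA AZA')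
  have "X \<star>\<^bsub>Is\<^esub> A \<star>\<^bsub>Js\<^esub> X = X"
    unfolding XA by (simp add: X_def einstein_assoc AZA')
  moreover have "X \<in> tensors Js Is"
    unfolding X_def Z_def
    by (intro einstein_tensors[OF einstein_tensors[OF ctranspose_tensors[OF W(1)] A] Y(1)])
  ultimately have "is_mp_inverse Is Js A X"
    by (simp add: is_mp_inverse_def AX XA ZA Y)
  then show ?thesis by blast
qed

text \<open>\<open>A X\<close> and \<open>A Y\<close> are Hermitian idempotents with the same range, and so equal; likewise
  for \<open>X A\<close> and \<open>Y A\<close>, whose kernels agree.  Hence \<open>X = X A X = X A Y = Y A Y = Y\<close>.\<close>

lemma is_mp_inverse_unique:
  assumes X: "is_mp_inverse Is Js A X" and Y: "is_mp_inverse Is Js A Y"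
  shows "X = Y"
proof -
  note eqs = X[unfolded is_mp_inverse_def] Y[unfolded is_mp_inverse_def]
  have "A \<star>\<^bsub>Js\<^esub> X = (A \<star>\<^bsub>Js\<^esub> Y \<star>\<^bsub>Is\<^esub> (A \<star>\<^bsub>Js\<^esub> X))\<^sup>H"
    using eqs by (metis einstein_assoc)
  also have "\<dots> = A \<star>\<^bsub>Js\<^esub> X \<star>\<^bsub>Is\<^esub> (A \<star>\<^bsub>Js\<^esub> Y)"
    using eqs by (simp only: ctranspose_einstein[of "A \<star>\<^bsub>Js\<^esub> Y"])
  also have "\<dots> = A \<star>\<^bsub>Js\<^esub> Y"
    using eqs by (metis einstein_assoc)
  finally have AX: "A \<star>\<^bsub>Js\<^esub> X = A \<star>\<^bsub>Js\<^esub> Y" .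
  have "X \<star>\<^bsub>Is\<^esub> A = (X \<star>\<^bsub>Is\<^esub> A \<star>\<^bsub>Js\<^esub> (Y \<star>\<^bsub>Is\<^esub> A))\<^sup>H"
    using eqs by (metis einstein_assoc)
  also have "\<dots> = Y \<star>\<^bsub>Is\<^esub> A \<star>\<^bsub>Js\<^esub> (X \<star>\<^bsub>Is\<^esub> A)"
    using eqs by (simp only: ctranspose_einstein[of "X \<star>\<^bsub>Is\<^esub> A"])
  also have "\<dots> = Y \<star>\<^bsub>Is\<^esub> A"
    using eqs by (metis einstein_assoc)
  finally have XA: "X \<star>\<^bsub>Is\<^esub> A = Y \<star>\<^bsub>Is\<^esub> A" .
  show ?thesis
    using eqs AX XA by (metis einstein_assoc)
qed

lemma mp_inverse_eqI: "is_mp_inverse Is Js A X \<Longrightarrow> mp_inverse Is Js A = X"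
  unfolding mp_inverse_def by (blast intro: is_mp_inverse_unique)

lemma is_mp_inverse_mp_inverse:
  "A \<in> tensors Is Js \<Longrightarrow> is_mp_inverse Is Js A (mp_inverse Is Js A)"
  using mp_inverse_exists mp_inverse_eqI by metis

lemma is_mp_inverse_ctranspose:
  assumes "is_mp_inverse Is Js A X"
  shows "is_mp_inverse Js Is (A\<^sup>H) (X\<^sup>H)"
  using assms unfolding is_mp_inverse_def
  by (metis ctranspose_tensors ctranspose_einstein einstein_assoc)

lemma mp_inverse_hermitian:
  assumes "A \<in> tensors Is Is" and "A\<^sup>H = A"
  shows "(mp_inverse Is Is A)\<^sup>H = mp_inverse Is Is A"
  using assms is_mp_inverse_ctranspose is_mp_inverse_mp_inverse is_mp_inverse_unique by metis

text \<open>The inverse factors as \<open>D = D D\<^sup>H A\<^sup>H = A\<^sup>H D\<^sup>H D\<close>, so it is annihilated from the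
  respective side by whatever annihilates \<open>A\<^sup>H\<close>.\<close>

lemma mp_inverse_annihilate:
  assumes D: "is_mp_inverse Is Js A D"
  shows "A\<^sup>H \<star>\<^bsub>Is\<^esub> Y = 0 \<Longrightarrow> D \<star>\<^bsub>Is\<^esub> Y = 0"
    and "Z \<star>\<^bsub>Js\<^esub> A\<^sup>H = 0 \<Longrightarrow> Z \<star>\<^bsub>Js\<^esub> D = 0"
proof -
  have 1: "D = D \<star>\<^bsub>Is\<^esub> (D\<^sup>H \<star>\<^bsub>Js\<^esub> A\<^sup>H)" and 2: "D = A\<^sup>H \<star>\<^bsub>Is\<^esub> (D\<^sup>H \<star>\<^bsub>Js\<^esub> D)"
    using D unfolding is_mp_inverse_def by (metis ctranspose_einstein einstein_assoc)+
  show "D \<star>\<^bsub>Is\<^esub> Y = 0" if "A\<^sup>H \<star>\<^bsub>Is\<^esub> Y = 0"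
    by (subst 1) (simp add: einstein_assoc that)
  show "Z \<star>\<^bsub>Js\<^esub> D = 0" if "Z \<star>\<^bsub>Js\<^esub> A\<^sup>H = 0"
    by (subst 2) (simp add: einstein_extend[OF that])
qed

section \<open>Column spaces as products\<close>

text \<open>Membership in the column space becomes a factorization and orthogonality the vanishing of
  a product, which is the form in which the computation uses them.\<close>

lemma columns_in_column_spaceE:
  assumes "X \<in> tensors Is Ks"
    and "\<forall>j\<in>multi_indices Ks. column_tensor X j \<in> column_space Js A"
  obtains C where "X = A \<star>\<^bsub>Js\<^esub> C"
proof -
  have "\<forall>j\<in>multi_indices Ks. \<exists>c. \<forall>i. X i j = (\<Sum>l\<in>multi_indices Js. c l * A i l)"
    using assms(2) by (auto simp: column_space_def column_tensor_def fun_eq_iff)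
  then obtain c where
    c: "\<And>i j. j \<in> multi_indices Ks \<Longrightarrow> X i j = (\<Sum>l\<in>multi_indices Js. c j l * A i l)"
    by metis
  have "X = A \<star>\<^bsub>Js\<^esub> (\<lambda>l j. if j \<in> multi_indices Ks then c j l else 0)"
  proof (intro ext)
    fix i j
    show "X i j = (A \<star>\<^bsub>Js\<^esub> (\<lambda>l j. if j \<in> multi_indices Ks then c j l else 0)) i j"
      using assms(1) by (cases "j \<in> multi_indices Ks")
        (auto simp: c einstein_def mult.commute tensors_def)
  qed
  then show thesis by (rule that)
qed

lemma columns_orthogonal:
  assumes "Y \<in> tensors Is Ks"
    and "\<forall>j\<in>multi_indices Ks. orthogonal_to_column_space Is A (column_tensor Y j)"
  shows "Y\<^sup>H \<star>\<^bsub>Is\<^esub> A = 0"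
proof (intro ext)
  fix j l
  show "(Y\<^sup>H \<star>\<^bsub>Is\<^esub> A) j l = 0 j l"
  proof (cases "j \<in> multi_indices Ks")
    case True
    then have "((single_column (column_tensor Y j))\<^sup>H \<star>\<^bsub>Is\<^esub> A) [] l = 0"
      using assms(2) by (simp add: orthogonal_to_column_space_def)
    then show ?thesis
      by (simp add: einstein_def ctranspose_def single_column_def column_tensor_def)
  next
    case False
    then show ?thesis
      using assms(1) by (simp add: einstein_def ctranspose_def tensors_def)
  qed
qed

section \<open>The inverse of the modified tensor\<close>

text \<open>The computation behind the theorem, in which \<open>X\<close>, \<open>Y\<close>, \<open>F\<close>, \<open>W\<close>, \<open>Z\<close>, \<open>E\<close>
  and \<open>B'\<close> stand for \<open>X\<^sub>1\<close>, \<open>Y\<^sub>1\<close>, \<open>E\<^sub>1\<^sup>H\<close>, \<open>X\<^sub>2\<^sup>H\<close>, \<open>Y\<^sub>2\<^sup>H\<close>, \<open>E\<^sub>2\<close> and \<open>B\<^sup>\<dagger>\<close>.  In \<open>S T\<close> the conditions on \<open>B\<close> turn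
  \<open>B (W + Z) T\<close> into \<open>F\<close>, and in \<open>T S\<close> they turn \<open>T (X + Y) B\<close> into \<open>E\<close>.\<close>

lemma is_mp_inverse_modified:
  assumes D: "is_mp_inverse m n A D"
    and tensors: "E \<in> tensors n k" "F \<in> tensors k m"
    and FA: "F \<star>\<^bsub>m\<^esub> A = 0" and FX: "F \<star>\<^bsub>m\<^esub> X = 0"
    and DY: "D \<star>\<^bsub>m\<^esub> Y = 0" and ADX: "A \<star>\<^bsub>n\<^esub> (D \<star>\<^bsub>m\<^esub> X) = X"
    and AE: "A \<star>\<^bsub>n\<^esub> E = 0" and WE: "W \<star>\<^bsub>n\<^esub> E = 0"
    and ZD: "Z \<star>\<^bsub>n\<^esub> D = 0" and WDA: "W \<star>\<^bsub>n\<^esub> (D \<star>\<^bsub>m\<^esub> A) = W"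
    and YF: "(Y \<star>\<^bsub>k\<^esub> F)\<^sup>H = Y \<star>\<^bsub>k\<^esub> F" and EZ: "(E \<star>\<^bsub>k\<^esub> Z)\<^sup>H = E \<star>\<^bsub>k\<^esub> Z"
    and EBFYB: "E \<star>\<^bsub>k\<^esub> (B' \<star>\<^bsub>k\<^esub> (F \<star>\<^bsub>m\<^esub> (Y \<star>\<^bsub>k\<^esub> B))) = E"
    and XFYB: "X \<star>\<^bsub>k\<^esub> (F \<star>\<^bsub>m\<^esub> (Y \<star>\<^bsub>k\<^esub> B)) = X \<star>\<^bsub>k\<^esub> B"
    and YFY: "Y \<star>\<^bsub>k\<^esub> (F \<star>\<^bsub>m\<^esub> Y) = Y"
    and BZEBF: "B \<star>\<^bsub>k\<^esub> (Z \<star>\<^bsub>n\<^esub> (E \<star>\<^bsub>k\<^esub> (B' \<star>\<^bsub>k\<^esub> F))) = F"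
    and BZEW: "B \<star>\<^bsub>k\<^esub> (Z \<star>\<^bsub>n\<^esub> (E \<star>\<^bsub>k\<^esub> W)) = B \<star>\<^bsub>k\<^esub> W"
    and EZE: "E \<star>\<^bsub>k\<^esub> (Z \<star>\<^bsub>n\<^esub> E) = E"
  shows "is_mp_inverse m n (A + (X + Y) \<star>\<^bsub>k\<^esub> B \<star>\<^bsub>k\<^esub> (W + Z))
    (D - E \<star>\<^bsub>k\<^esub> W \<star>\<^bsub>n\<^esub> D - D \<star>\<^bsub>m\<^esub> X \<star>\<^bsub>k\<^esub> F
      + E \<star>\<^bsub>k\<^esub> (B' + W \<star>\<^bsub>n\<^esub> D \<star>\<^bsub>m\<^esub> X) \<star>\<^bsub>k\<^esub> F)"
    (is "is_mp_inverse m n ?S ?T")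
proof -
  have D_tensor: "D \<in> tensors n m" and ADA: "A \<star>\<^bsub>n\<^esub> (D \<star>\<^bsub>m\<^esub> A) = A"
    and DAD: "D \<star>\<^bsub>m\<^esub> (A \<star>\<^bsub>n\<^esub> D) = D"
    and AD: "(A \<star>\<^bsub>n\<^esub> D)\<^sup>H = A \<star>\<^bsub>n\<^esub> D" and DA: "(D \<star>\<^bsub>m\<^esub> A)\<^sup>H = D \<star>\<^bsub>m\<^esub> A"
    using D by (simp_all add: is_mp_inverse_def einstein_assoc)
  note zeros = FA FX DY AE WE ZD
  note rules = einstein_assoc einstein_distribs zeros zeros[THEN einstein_extend]
  have ADX': "A \<star>\<^bsub>n\<^esub> (D \<star>\<^bsub>m\<^esub> (X \<star>\<^bsub>k\<^esub> V)) = X \<star>\<^bsub>k\<^esub> V" for V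
    using einstein_extend[OF ADX] by (simp add: einstein_assoc)
  have BZEW': "B \<star>\<^bsub>k\<^esub> (Z \<star>\<^bsub>n\<^esub> (E \<star>\<^bsub>k\<^esub> (W \<star>\<^bsub>n\<^esub> V))) = B \<star>\<^bsub>k\<^esub> (W \<star>\<^bsub>n\<^esub> V)" for V
    using arg_cong[OF BZEW, of "\<lambda>t. t \<star>\<^bsub>n\<^esub> V"] by (simp add: einstein_assoc)
  have YFY': "Y \<star>\<^bsub>k\<^esub> (F \<star>\<^bsub>m\<^esub> (Y \<star>\<^bsub>k\<^esub> V)) = Y \<star>\<^bsub>k\<^esub> V" for V
    using einstein_extend[OF YFY] by (simp add: einstein_assoc)
  have EZE': "E \<star>\<^bsub>k\<^esub> (Z \<star>\<^bsub>n\<^esub> (E \<star>\<^bsub>k\<^esub> V)) = E \<star>\<^bsub>k\<^esub> V" for V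
    using einstein_extend[OF EZE] by (simp add: einstein_assoc)
  have AT: "A \<star>\<^bsub>n\<^esub> ?T = A \<star>\<^bsub>n\<^esub> D - X \<star>\<^bsub>k\<^esub> F"
    by (simp add: rules ADX')
  have BT: "B \<star>\<^bsub>k\<^esub> ((W + Z) \<star>\<^bsub>n\<^esub> ?T) = F"
    by (simp add: rules BZEW' BZEBF)
  have "?S \<star>\<^bsub>n\<^esub> ?T = A \<star>\<^bsub>n\<^esub> ?T + (X + Y) \<star>\<^bsub>k\<^esub> (B \<star>\<^bsub>k\<^esub> ((W + Z) \<star>\<^bsub>n\<^esub> ?T))"
    by (simp only: einstein_assoc einstein_distribs(1)[of A])
  then have ST: "?S \<star>\<^bsub>n\<^esub> ?T = A \<star>\<^bsub>n\<^esub> D + Y \<star>\<^bsub>k\<^esub> F"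
    unfolding AT BT by (simp add: einstein_distribs)
  have TA: "?T \<star>\<^bsub>m\<^esub> A = D \<star>\<^bsub>m\<^esub> A - E \<star>\<^bsub>k\<^esub> W"
    by (simp add: rules WDA)
  have TB: "?T \<star>\<^bsub>m\<^esub> ((X + Y) \<star>\<^bsub>k\<^esub> B) = E"
    by (simp add: rules XFYB EBFYB)
  have "?T \<star>\<^bsub>m\<^esub> ?S = ?T \<star>\<^bsub>m\<^esub> A + ?T \<star>\<^bsub>m\<^esub> ((X + Y) \<star>\<^bsub>k\<^esub> B) \<star>\<^bsub>k\<^esub> (W + Z)"
    by (simp only: einstein_assoc einstein_distribs(2)[of _ m A])
  then have TS: "?T \<star>\<^bsub>m\<^esub> ?S = D \<star>\<^bsub>m\<^esub> A + E \<star>\<^bsub>k\<^esub> Z"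
    unfolding TA TB by (simp add: einstein_distribs)
  have "?S \<star>\<^bsub>n\<^esub> ?T \<star>\<^bsub>m\<^esub> ?S = ?S"
    unfolding ST by (simp add: rules ADA ADX' YFY')
  moreover have "?T \<star>\<^bsub>m\<^esub> ?S \<star>\<^bsub>n\<^esub> ?T = ?T"
    unfolding TS by (simp add: rules DAD ADX' EZE')
  moreover have "?T \<in> tensors n m"
    using D_tensor tensors by (auto simp: tensors_def einstein_def)
  ultimately show ?thesis
    unfolding is_mp_inverse_def ST TS by (simp add: ctranspose_add AD DA YF EZ)
qed

theorem theorem4p1:
  fixes I :: "nat \<Rightarrow> nat" and M N K :: nat
    and m n k :: "nat list"
    and A B U V X1 Y1 X2 Y2 E1 E2 S :: tensor
  assumes m: "m = dims I M" and n: "n = dims I N" and k: "k = dims I K"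
    and A: "A \<in> tensors m n" and B: "B \<in> tensors k k"
    and U: "U \<in> tensors m k" and V: "V \<in> tensors k n"
    and X1: "X1 \<in> tensors m k" and Y1: "Y1 \<in> tensors m k"
    and X2: "X2 \<in> tensors n k" and Y2: "Y2 \<in> tensors n k"
    and U_split: "U = X1 + Y1"
    and X1_col: "\<forall>j\<in>multi_indices k. column_tensor X1 j \<in> column_space n A"
    and Y1_orth: "\<forall>j\<in>multi_indices k. orthogonal_to_column_space m A (column_tensor Y1 j)"
    and V_split: "V\<^sup>H = X2 + Y2"
    and X2_col: "\<forall>j\<in>multi_indices k. column_tensor X2 j \<in> column_space m (A\<^sup>H)"
    and Y2_orth: "\<forall>j\<in>multi_indices k. orthogonal_to_column_space n (A\<^sup>H) (column_tensor Y2 j)"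
    and E1: "E1 = Y1 \<star>\<^bsub>k\<^esub> mp_inverse k k (Y1\<^sup>H \<star>\<^bsub>m\<^esub> Y1)"
    and E2: "E2 = Y2 \<star>\<^bsub>k\<^esub> mp_inverse k k (Y2\<^sup>H \<star>\<^bsub>n\<^esub> Y2)"
    and c3a: "E2 \<star>\<^bsub>k\<^esub> mp_inverse k k B \<star>\<^bsub>k\<^esub> E1\<^sup>H \<star>\<^bsub>m\<^esub> Y1 \<star>\<^bsub>k\<^esub> B = E2"
    and c3b: "X1 \<star>\<^bsub>k\<^esub> E1\<^sup>H \<star>\<^bsub>m\<^esub> Y1 \<star>\<^bsub>k\<^esub> B = X1 \<star>\<^bsub>k\<^esub> B"
    and c3c: "Y1 \<star>\<^bsub>k\<^esub> E1\<^sup>H \<star>\<^bsub>m\<^esub> Y1 = Y1"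
    and c4a: "B \<star>\<^bsub>k\<^esub> Y2\<^sup>H \<star>\<^bsub>n\<^esub> E2 \<star>\<^bsub>k\<^esub> mp_inverse k k B \<star>\<^bsub>k\<^esub> E1\<^sup>H = E1\<^sup>H"
    and c4b: "B \<star>\<^bsub>k\<^esub> Y2\<^sup>H \<star>\<^bsub>n\<^esub> E2 \<star>\<^bsub>k\<^esub> X2\<^sup>H = B \<star>\<^bsub>k\<^esub> X2\<^sup>H"
    and c4c: "E2 \<star>\<^bsub>k\<^esub> Y2\<^sup>H \<star>\<^bsub>n\<^esub> E2 = E2"
    and S: "S = A + U \<star>\<^bsub>k\<^esub> B \<star>\<^bsub>k\<^esub> V"
  shows "S = A + (X1 + Y1) \<star>\<^bsub>k\<^esub> B \<star>\<^bsub>k\<^esub> (X2 + Y2)\<^sup>H \<and>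
    is_mp_inverse m n S (mp_inverse m n S) \<and>
    mp_inverse m n S =
      mp_inverse m n A
      - E2 \<star>\<^bsub>k\<^esub> X2\<^sup>H \<star>\<^bsub>n\<^esub> mp_inverse m n A
      - mp_inverse m n A \<star>\<^bsub>m\<^esub> X1 \<star>\<^bsub>k\<^esub> E1\<^sup>H
      + E2 \<star>\<^bsub>k\<^esub> (mp_inverse k k B + X2\<^sup>H \<star>\<^bsub>n\<^esub> mp_inverse m n A \<star>\<^bsub>m\<^esub> X1) \<star>\<^bsub>k\<^esub> E1\<^sup>H"
proof -
  define D where "D = mp_inverse m n A"
  define B' where "B' = mp_inverse k k B"
  define G1 where "G1 = mp_inverse k k (Y1\<^sup>H \<star>\<^bsub>m\<^esub> Y1)"
  define G2 where "G2 = mp_inverse k k (Y2\<^sup>H \<star>\<^bsub>n\<^esub> Y2)"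
  have D: "is_mp_inverse m n A D"
    unfolding D_def using A by (rule is_mp_inverse_mp_inverse)
  have ADA: "A \<star>\<^bsub>n\<^esub> (D \<star>\<^bsub>m\<^esub> A) = A"
    using D by (simp add: is_mp_inverse_def einstein_assoc)
  have gram: "Y1\<^sup>H \<star>\<^bsub>m\<^esub> Y1 \<in> tensors k k" "Y2\<^sup>H \<star>\<^bsub>n\<^esub> Y2 \<in> tensors k k"
    using Y1 Y2 by (auto intro: einstein_tensors ctranspose_tensors)
  have G: "G1 \<in> tensors k k" "G2 \<in> tensors k k"
    unfolding G1_def G2_def using gram[THEN is_mp_inverse_mp_inverse]
    by (simp_all add: is_mp_inverse_def)
  have GH: "G1\<^sup>H = G1" "G2\<^sup>H = G2"
    unfolding G1_def G2_def using gram[THEN mp_inverse_hermitian]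
    by (simp_all add: ctranspose_einstein)
  have E1': "E1\<^sup>H = G1 \<star>\<^bsub>k\<^esub> Y1\<^sup>H" and E2': "E2 = Y2 \<star>\<^bsub>k\<^esub> G2"
    using E1 E2 GH by (simp_all add: G1_def G2_def ctranspose_einstein)
  have E: "E2 \<in> tensors n k" "E1\<^sup>H \<in> tensors k m"
    unfolding E1' E2' using G Y1 Y2 by (auto intro: einstein_tensors ctranspose_tensors)
  obtain C1 where C1: "X1 = A \<star>\<^bsub>n\<^esub> C1"
    using columns_in_column_spaceE[OF X1 X1_col] .
  obtain C2 where C2: "X2 = A\<^sup>H \<star>\<^bsub>m\<^esub> C2"
    using columns_in_column_spaceE[OF X2 X2_col] .
  have X2': "X2\<^sup>H = C2\<^sup>H \<star>\<^bsub>m\<^esub> A"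
    by (simp add: C2 ctranspose_einstein)
  have Y1A: "Y1\<^sup>H \<star>\<^bsub>m\<^esub> A = 0"
    using Y1 Y1_orth by (rule columns_orthogonal)
  have Y2A: "Y2\<^sup>H \<star>\<^bsub>n\<^esub> A\<^sup>H = 0"
    using Y2 Y2_orth by (rule columns_orthogonal)
  have AY1: "A\<^sup>H \<star>\<^bsub>m\<^esub> Y1 = 0" and AY2: "A \<star>\<^bsub>n\<^esub> Y2 = 0"
    using Y1A[THEN arg_cong, of ctranspose] Y2A[THEN arg_cong, of ctranspose]
    by (simp_all add: ctranspose_einstein)
  have V': "V = X2\<^sup>H + Y2\<^sup>H"
    using V_split ctranspose_ctranspose[of V] by (simp add: ctranspose_add)
  have S': "S = A + (X1 + Y1) \<star>\<^bsub>k\<^esub> B \<star>\<^bsub>k\<^esub> (X2\<^sup>H + Y2\<^sup>H)"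
    using S U_split V' by simp
  have main: "is_mp_inverse m n S
    (D - E2 \<star>\<^bsub>k\<^esub> X2\<^sup>H \<star>\<^bsub>n\<^esub> D - D \<star>\<^bsub>m\<^esub> X1 \<star>\<^bsub>k\<^esub> E1\<^sup>H
      + E2 \<star>\<^bsub>k\<^esub> (B' + X2\<^sup>H \<star>\<^bsub>n\<^esub> D \<star>\<^bsub>m\<^esub> X1) \<star>\<^bsub>k\<^esub> E1\<^sup>H)"
    unfolding S'
  proof (rule is_mp_inverse_modified[OF D E])
    show "E1\<^sup>H \<star>\<^bsub>m\<^esub> A = 0" "E1\<^sup>H \<star>\<^bsub>m\<^esub> X1 = 0"
      by (simp_all add: E1' C1 einstein_assoc Y1A einstein_extend[OF Y1A])
    show "A \<star>\<^bsub>n\<^esub> E2 = 0" "X2\<^sup>H \<star>\<^bsub>n\<^esub> E2 = 0"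
      by (simp_all add: E2' X2' einstein_assoc einstein_extend[OF AY2])
    show "D \<star>\<^bsub>m\<^esub> Y1 = 0" "Y2\<^sup>H \<star>\<^bsub>n\<^esub> D = 0"
      using mp_inverse_annihilate[OF D] AY1 Y2A by auto
    show "A \<star>\<^bsub>n\<^esub> (D \<star>\<^bsub>m\<^esub> X1) = X1"
      using einstein_extend[OF ADA] by (simp add: C1 einstein_assoc)
    show "X2\<^sup>H \<star>\<^bsub>n\<^esub> (D \<star>\<^bsub>m\<^esub> A) = X2\<^sup>H"
      by (simp add: X2' einstein_assoc ADA)
    show "(Y1 \<star>\<^bsub>k\<^esub> E1\<^sup>H)\<^sup>H = Y1 \<star>\<^bsub>k\<^esub> E1\<^sup>H" "(E2 \<star>\<^bsub>k\<^esub> Y2\<^sup>H)\<^sup>H = E2 \<star>\<^bsub>k\<^esub> Y2\<^sup>H"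
      unfolding E1' E2' by (simp_all add: ctranspose_einstein einstein_assoc GH)
  qed (use c3a c3b c3c c4a c4b c4c in \<open>simp_all add: B'_def einstein_assoc\<close>)
  show ?thesis
    using S' main mp_inverse_eqI[OF main] by (simp add: ctranspose_add D_def B'_def)
qed

end
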